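(* For $\lambda>0$ define $P_\lambda:\{0,1,2,\dots\}\to\mathbb R$ by $$P_\lambda(0)=\mathrm e^{-\lambda}\sum_{k=1}^\infty\frac{\lambda^k}{k!\,k},\qquad P_\lambda(r)=\mathrm e^{-\lambda}\sum_{k=r+1}^\infty\frac{\lambda^k}{k!}\,\frac rk\sum_{j=r}^{k-1}\frac1j\quad(r\ge1).$$ Let $(p_j,q_j)$ be integer pairs such that $q_j\to\infty$ and $p_j-\frac1{\mathrm e}q_j\to0$. Then, for all sufficiently large $j$, $p_j-1$ is the unique optimal threshold for the Poisson model with mean $q_j$, i.e. the unique maximizer of $P_{q_j}$ over $\{0,1,2,\dots\}$.
   Context: Model: the number $N$ of applicants is Poisson with mean $\lambda$, arriving in uniformly random order; the rule with threshold $r$ rejects the first $r$ applicants and accepts the first subsequent record; $P_\lambda(r)$ is the probability of selecting the best applicant. *)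

theory Defs
  imports "HOL-Analysis.Analysis"
begin

text \<open>
  Best-choice problem in which the number of applicants is Poisson distributed with mean \<open>\<mu>\<close>:
  the probability of selecting the best applicant when the first \<open>r\<close> applicants are rejected and
  the first subsequent record is accepted. The index \<open>k\<close> is the number of applicants that
  actually arrive. The values are meaningful for \<open>\<mu> > 0\<close>.
\<close>

definition success_prob :: "real \<Rightarrow> nat \<Rightarrow> real" where
  "success_prob \<mu> r =
     (if r = 0
      then exp (- \<mu>) * (\<Sum>\<^sub>\<infinity>k\<in>{1..}. \<mu> ^ k / (fact k * real k))
      else exp (- \<mu>) * (\<Sum>\<^sub>\<infinity>k\<in>{r + 1..}.
             \<mu> ^ k / fact k * (real r / real k) * (\<Sum>j=r..k - 1. 1 / real j)))"

definition optimal_thresholds :: "real \<Rightarrow> nat set" where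
  "optimal_thresholds \<mu> = {r. \<forall>s. success_prob \<mu> s \<le> success_prob \<mu> r}"

end

theory Submission
  imports Defs
begin

text \<open>
  Write \<open>\<pi>(k)\<close> for the Poisson weights and \<open>H\<close> for the harmonic numbers. The increment
  \<open>D(r) = P(r+1) - P(r)\<close> equals \<open>\<Sum>k>r. \<pi>(k) (H(k-1) - H(r) - 1) / k\<close>, and
  \<open>D(r) - D(r-1) = (\<pi>(r) - a(r)) / r\<close> with \<open>a(r) = \<Sum>k>r. \<pi>(k) / k\<close>. Once \<open>a(r) < \<pi>(r)\<close> holds it
  holds for all larger \<open>r\<close>, so \<open>D\<close> first decreases and then increases strictly to its limit 0. Hence
  \<open>D(r-1) > 0 > D(r)\<close> already forces \<open>r\<close> to be the unique maximizer.

  A second-order expansion around \<open>k = \<lambda>\<close> gives \<open>\<lambda>\<^sup>2 D(\<lambda>/e + \<delta>) \<rightarrow> -e\<delta> - 2 - e/2\<close>, which is positive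
  for \<open>\<delta> = -2\<close> and negative for \<open>\<delta> = -1\<close>. Both signs survive replacing the summand by cruder quartic
  polynomial bounds in \<open>k/\<lambda> - 1\<close>, whose Poisson expectations are explicit; the quartic term makes the
  bounds valid also for the small \<open>k\<close>, where the summand is cut off.
\<close>

section \<open>Poisson weights and their moments\<close>

definition poisson_weight :: "real \<Rightarrow> nat \<Rightarrow> real" where
  "poisson_weight l k = exp (- l) * l ^ k / fact k"

lemma poisson_weight_pos: "l > 0 \<Longrightarrow> poisson_weight l k > 0"
  by (simp add: poisson_weight_def)

lemma poisson_weight_Suc:
  "poisson_weight l (Suc k) = poisson_weight l k * l / real (Suc k)"
  by (simp add: poisson_weight_def field_simps)

lemma poisson_weight_sums: "poisson_weight l sums 1"
proof -
  have "(\<lambda>k. exp (- l) * (l ^ k /\<^sub>R fact k)) sums (exp (- l) * exp l)"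
    by (rule sums_mult[OF exp_converges])
  moreover have "exp (- l) * exp l = 1"
    by (simp add: exp_minus)
  ultimately show ?thesis
    by (simp add: poisson_weight_def[abs_def] divide_inverse mult_ac)
qed

lemma summable_poisson_weight: "summable (poisson_weight l)"
  using poisson_weight_sums by (rule sums_summable)

text \<open>Stein's identity for the Poisson law. Expanding \<open>(k + 1) ^ n\<close> in it yields
  each moment from the lower ones.\<close>

lemma poisson_weight_shift_sums:
  assumes "(\<lambda>k. poisson_weight l k * f (Suc k)) sums s"
  shows "(\<lambda>k. poisson_weight l k * (real k * f k)) sums (l * s)"
proof -
  have "(\<lambda>k. l * (poisson_weight l k * f (Suc k))) sums (l * s)"
    by (rule sums_mult[OF assms])
  moreover have "l * (poisson_weight l k * f (Suc k))
      = poisson_weight l (Suc k) * (real (Suc k) * f (Suc k))" for k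
    by (simp add: poisson_weight_Suc del: of_nat_Suc)
  ultimately have "(\<lambda>k. poisson_weight l (Suc k) * (real (Suc k) * f (Suc k))) sums (l * s)"
    by simp
  then show ?thesis
    by (subst (asm) sums_Suc_iff) simp
qed

lemma poisson_moment1: "(\<lambda>k. poisson_weight l k * real k) sums l"
  using poisson_weight_shift_sums[of l "\<lambda>_. 1" 1] poisson_weight_sums by simp

lemma poisson_moment2: "(\<lambda>k. poisson_weight l k * real k ^ 2) sums (l * (l + 1))"
proof -
  have "(\<lambda>k. poisson_weight l k * real (Suc k)) sums (l + 1)"
    using sums_add[OF poisson_moment1[of l] poisson_weight_sums[of l]] by (simp add: algebra_simps)
  from poisson_weight_shift_sums[OF this] show ?thesis
    by (simp add: power2_eq_square)
qed

lemma poisson_moment3: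
  "(\<lambda>k. poisson_weight l k * real k ^ 3) sums (l * (l\<^sup>2 + 3 * l + 1))"
proof -
  have "(\<lambda>k. poisson_weight l k * real k ^ 2 + 2 * (poisson_weight l k * real k)
      + poisson_weight l k) sums (l * (l + 1) + 2 * l + 1)"
    by (intro sums_add sums_mult poisson_moment1 poisson_moment2 poisson_weight_sums)
  then have "(\<lambda>k. poisson_weight l k * real (Suc k) ^ 2) sums (l\<^sup>2 + 3 * l + 1)"
    by (simp add: algebra_simps power2_eq_square)
  from poisson_weight_shift_sums[OF this] show ?thesis
    by (simp add: power2_eq_square power3_eq_cube mult_ac)
qed

lemma poisson_moment4:
  "(\<lambda>k. poisson_weight l k * real k ^ 4) sums (l * (l ^ 3 + 6 * l\<^sup>2 + 7 * l + 1))"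
proof -
  have "(\<lambda>k. poisson_weight l k * real k ^ 3 + 3 * (poisson_weight l k * real k ^ 2)
      + 3 * (poisson_weight l k * real k) + poisson_weight l k)
      sums (l * (l\<^sup>2 + 3 * l + 1) + 3 * (l * (l + 1)) + 3 * l + 1)"
    by (intro sums_add sums_mult poisson_moment1 poisson_moment2 poisson_moment3
        poisson_weight_sums)
  then have "(\<lambda>k. poisson_weight l k * real (Suc k) ^ 3) sums (l ^ 3 + 6 * l\<^sup>2 + 7 * l + 1)"
    by (simp add: algebra_simps power2_eq_square power3_eq_cube)
  from poisson_weight_shift_sums[OF this] show ?thesis
    by (simp add: power3_eq_cube power4_eq_xxxx mult_ac)
qed

text \<open>The central moments behind this are 0, \<open>l\<close> and \<open>3 * l^2 + l\<close>
  in orders 1, 2 and 4. The linear coefficient leaves no trace in the value, so it may later be of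
  order \<open>l\<close>.\<close>

lemma poisson_scaled_quartic_sums:
  fixes l a b c d :: real
  assumes l: "l > 0"
  shows "(\<lambda>k. poisson_weight l k * (a + b * (real k / l - 1) + c * (real k / l - 1)\<^sup>2
            + d * (real k / l - 1) ^ 4))
         sums (a + c / l + d * (3 / l\<^sup>2 + 1 / l ^ 3))"
proof -
  let ?w = "poisson_weight l"
  let ?c0 = "a - b + c + d" and ?c1 = "(b - 2 * c - 4 * d) / l" and ?c2 = "(c + 6 * d) / l\<^sup>2"
  let ?c3 = "- 4 * d / l ^ 3" and ?c4 = "d / l ^ 4"
  have "(\<lambda>k. ?c0 * ?w k + ?c1 * (?w k * real k) + ?c2 * (?w k * real k ^ 2)
        + ?c3 * (?w k * real k ^ 3) + ?c4 * (?w k * real k ^ 4))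
      sums (?c0 * 1 + ?c1 * l + ?c2 * (l * (l + 1)) + ?c3 * (l * (l\<^sup>2 + 3 * l + 1))
        + ?c4 * (l * (l ^ 3 + 6 * l\<^sup>2 + 7 * l + 1)))"
    by (intro sums_add sums_mult poisson_moment1 poisson_moment2 poisson_moment3
        poisson_moment4 poisson_weight_sums)
  moreover have "?c0 * 1 + ?c1 * l + ?c2 * (l * (l + 1)) + ?c3 * (l * (l\<^sup>2 + 3 * l + 1))
        + ?c4 * (l * (l ^ 3 + 6 * l\<^sup>2 + 7 * l + 1)) = a + c / l + d * (3 / l\<^sup>2 + 1 / l ^ 3)"
    using l by (simp add: field_simps power2_eq_square power3_eq_cube power4_eq_xxxx)
  moreover have "?c0 * ?w k + ?c1 * (?w k * real k) + ?c2 * (?w k * real k ^ 2)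
        + ?c3 * (?w k * real k ^ 3) + ?c4 * (?w k * real k ^ 4)
      = ?w k * (a + b * (real k / l - 1) + c * (real k / l - 1)\<^sup>2
            + d * (real k / l - 1) ^ 4)" for k
    using l by (simp add: field_simps power2_eq_square power3_eq_cube power4_eq_xxxx)
  ultimately show ?thesis by (simp only:)
qed

section \<open>Increments of the success probability\<close>

text \<open>Success probability given \<open>k\<close> applicants. The value 0 for
  \<open>k <= r\<close> lets the Poisson mixture run over all \<open>k\<close>.\<close>

definition cond_success :: "nat \<Rightarrow> nat \<Rightarrow> real" where
  "cond_success r k = (if r < k
     then (if r = 0 then 1 / real k else real r / real k * (harm (k - 1) - harm (r - 1)))
     else 0)"

definition cond_gain :: "nat \<Rightarrow> nat \<Rightarrow> real" where
  "cond_gain r k = (if r < k then (harm (k - 1) - harm r - 1) / real k else 0)"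

definition gain :: "real \<Rightarrow> nat \<Rightarrow> real" where
  "gain l r = (\<Sum>k. poisson_weight l k * cond_gain r k)"

lemma harm_diff_eq_sum:
  assumes "r \<le> n"
  shows "(harm n - harm r :: real) = (\<Sum>j=Suc r..n. 1 / real j)"
  using assms
proof (induction n rule: dec_induct)
  case (step n)
  then show ?case by (simp add: harm_Suc inverse_eq_divide)
qed simp

lemma harm_diff_bounds:
  assumes "r \<le> n"
  shows "0 \<le> (harm n - harm r :: real)" "(harm n - harm r :: real) \<le> real n - real r"
proof -
  show "0 \<le> (harm n - harm r :: real)"
    unfolding harm_diff_eq_sum[OF assms] by (intro sum_nonneg) simp
  have "(\<Sum>j=Suc r..n. 1 / real j) \<le> (\<Sum>j=Suc r..n. 1)"
    by (intro sum_mono) simp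
  then show "(harm n - harm r :: real) \<le> real n - real r"
    unfolding harm_diff_eq_sum[OF assms] using assms by (simp add: of_nat_diff)
qed

lemma cond_success_nonneg: "0 \<le> cond_success r k"
  using harm_diff_bounds(1)[of "r - 1" "k - 1"] by (auto simp: cond_success_def)

lemma cond_success_le: "cond_success r k \<le> real r + 1"
proof (cases "r < k \<and> r \<noteq> 0")
  case True
  then have "harm (k - 1) - harm (r - 1) \<le> real (k - 1) - real (r - 1)"
    by (intro harm_diff_bounds(2) diff_le_mono) simp
  also have "\<dots> \<le> real k" using True by auto
  finally have "real r / real k * (harm (k - 1) - harm (r - 1)) \<le> real r / real k * real k"
    by (intro mult_left_mono) auto
  also have "\<dots> = real r" using True by simp
  finally show ?thesis using True by (simp add: cond_success_def)
next
  case False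
  then show ?thesis by (auto simp: cond_success_def divide_le_eq)
qed

lemma summable_poisson_weight_mult:
  assumes l: "l > 0" and b: "\<And>k. \<bar>f k\<bar> \<le> C"
  shows "summable (\<lambda>k. poisson_weight l k * f k)"
proof (rule summable_comparison_test')
  show "summable (\<lambda>k. poisson_weight l k * C)"
    by (intro summable_mult2 summable_poisson_weight)
  show "norm (poisson_weight l k * f k) \<le> poisson_weight l k * C" if "k \<ge> 0" for k
    using b[of k] poisson_weight_pos[OF l, of k] by (simp add: abs_mult mult_left_mono)
qed

text \<open>Absolute convergence turns the unordered sum into an ordinary series, which can be
  subtracted termwise.\<close>

lemma success_prob_eq_suminf:
  assumes l: "l > 0"
  shows "success_prob l r = (\<Sum>k. poisson_weight l k * cond_success r k)"
proof -
  have summ: "summable (\<lambda>k. norm (poisson_weight l k * cond_success r k))"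
    using summable_poisson_weight_mult[OF l, of "cond_success r" "real r + 1"]
      cond_success_nonneg cond_success_le
    by (simp add: abs_mult abs_of_pos[OF poisson_weight_pos[OF l]])
  have "(\<Sum>k. poisson_weight l k * cond_success r k)
      = (\<Sum>\<^sub>\<infinity>k. poisson_weight l k * cond_success r k)"
    by (intro infsumI[symmetric] norm_summable_imp_has_sum[OF summ] summable_sums
        summable_norm_cancel[OF summ])
  also have "\<dots> = success_prob l r"
  proof (cases "r = 0")
    case True
    have "(\<Sum>\<^sub>\<infinity>k. poisson_weight l k * cond_success r k)
        = (\<Sum>\<^sub>\<infinity>k\<in>{1..}. exp (- l) * (l ^ k / (fact k * real k)))"
      by (rule infsum_cong_neutral) (auto simp: True cond_success_def poisson_weight_def)
    then show ?thesis by (simp only: success_prob_def True if_True infsum_cmult_right' simp_thms)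
  next
    case False
    have "(\<Sum>\<^sub>\<infinity>k. poisson_weight l k * cond_success r k)
        = (\<Sum>\<^sub>\<infinity>k\<in>{r + 1..}. exp (- l) *
            (l ^ k / fact k * (real r / real k) * (\<Sum>j=r..k - 1. 1 / real j)))"
    proof (rule infsum_cong_neutral)
      fix k assume "k \<in> UNIV \<inter> {r + 1..}"
      then have "r < k" by simp
      then have "harm (k - 1) - harm (r - 1) = (\<Sum>j=r..k - 1. 1 / real j)"
        using harm_diff_eq_sum[of "r - 1" "k - 1"] False by simp
      then show "poisson_weight l k * cond_success r k = exp (- l) *
            (l ^ k / fact k * (real r / real k) * (\<Sum>j=r..k - 1. 1 / real j))"
        using \<open>r < k\<close> False by (simp add: cond_success_def poisson_weight_def)
    qed (auto simp: cond_success_def)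
    then show ?thesis using False by (simp only: success_prob_def if_False infsum_cmult_right')
  qed
  finally show ?thesis ..
qed

text \<open>The case \<open>k = r + 1\<close> fits the formula although
  \<open>cond_success (Suc r) k\<close> is cut off to 0 there, because
  \<open>harm (k - 1) - harm r\<close> vanishes too.\<close>

lemma cond_success_Suc: "cond_success (Suc r) k - cond_success r k = cond_gain r k"
proof (cases "r < k")
  case True
  show ?thesis
  proof (cases "r = 0")
    case True
    then show ?thesis using \<open>r < k\<close>
      by (cases "k = 1") (auto simp: cond_success_def cond_gain_def harm_def diff_divide_distrib)
  next
    case False
    then obtain m where m: "r = Suc m" by (cases r) auto
    have h: "(harm r :: real) = harm m + 1 / real r"
      by (simp add: m harm_Suc inverse_eq_divide)
    show ?thesis
    proof (cases "k = Suc r")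
      case True
      then show ?thesis using h
        by (simp add: cond_success_def cond_gain_def m field_simps)
    next
      case False
      then have "Suc r < k" using \<open>r < k\<close> by simp
      \<comment> \<open>The term \<open>j = r\<close> contributes \<open>r * (1 / r) = 1\<close>,
        the source of the \<open>- 1\<close> in \<open>cond_gain\<close>.\<close>
      moreover have "real r * (harm (k - 1) - harm m) = real r * (harm (k - 1) - harm r) + 1"
        using h by (simp add: m algebra_simps)
      ultimately show ?thesis using m \<open>r < k\<close>
        by (simp add: cond_success_def cond_gain_def diff_divide_distrib[symmetric])
          (simp add: algebra_simps)
    qed
  qed
qed (simp add: cond_success_def cond_gain_def)

lemma abs_cond_gain_le: "\<bar>cond_gain r k\<bar> \<le> (if r < k then 1 else 0)"
proof (cases "r < k")
  case True
  then have "r \<le> k - 1" by simp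
  then have "\<bar>harm (k - 1) - harm r - 1 :: real\<bar> \<le> real k"
    using harm_diff_bounds[of r "k - 1"] True by (simp add: of_nat_diff abs_le_iff)
  then show ?thesis using True by (simp add: cond_gain_def divide_le_eq)
qed (simp add: cond_gain_def)

lemma abs_cond_gain_le_1: "\<bar>cond_gain r k\<bar> \<le> 1"
  using abs_cond_gain_le[of r k] by (auto split: if_splits)

lemma summable_cond_gain:
  "l > 0 \<Longrightarrow> summable (\<lambda>k. poisson_weight l k * cond_gain r k)"
  by (rule summable_poisson_weight_mult[OF _ abs_cond_gain_le_1])

lemma success_prob_Suc:
  assumes l: "l > 0"
  shows "success_prob l (Suc r) - success_prob l r = gain l r"
proof -
  have s: "summable (\<lambda>k. poisson_weight l k * cond_success r k)" for r
    by (rule summable_poisson_weight_mult[OF l, of _ "real r + 1"])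
       (simp add: cond_success_nonneg cond_success_le)
  show ?thesis
    unfolding success_prob_eq_suminf[OF l] suminf_diff[OF s s] gain_def
      cond_success_Suc[symmetric] by (simp add: algebra_simps)
qed

text \<open>The summands vanish for \<open>k <= r\<close> and are otherwise at most a Poisson
  weight, so a tail of the weights dominates.\<close>

lemma gain_tendsto_0:
  assumes l: "l > 0"
  shows "gain l \<longlonglongrightarrow> 0"
proof (rule LIMSEQ_I)
  fix e :: real assume "e > 0"
  from suminf_exist_split[OF this summable_poisson_weight[of l]] obtain N
    where N: "\<And>n. n \<ge> N \<Longrightarrow> norm (\<Sum>i. poisson_weight l (i + n)) < e" by blast
  have "norm (gain l r - 0) < e" if "r \<ge> N" for r
  proof -
    have b: "norm (poisson_weight l k * cond_gain r k)
        \<le> (if k < r then 0 else poisson_weight l k)" for k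
      using mult_left_mono[OF abs_cond_gain_le[of r k] less_imp_le[OF poisson_weight_pos[OF l, of k]]]
        poisson_weight_pos[OF l, of k]
      by (auto simp: abs_mult split: if_splits)
    have s: "(\<lambda>k. if k < r then 0 else poisson_weight l k) sums (\<Sum>i. poisson_weight l (i + r))"
    proof -
      have "(\<lambda>i. poisson_weight l (i + r)) sums (\<Sum>i. poisson_weight l (i + r))"
        using summable_poisson_weight by (simp add: summable_sums)
      then show ?thesis
        by (subst sums_iff_shift'[of _ r, symmetric]) simp
    qed
    have "norm (gain l r) \<le> (\<Sum>k. if k < r then 0 else poisson_weight l k)"
      unfolding gain_def by (rule norm_suminf_le[OF b sums_summable[OF s]])
    also have "\<dots> < e" using N[OF that] sums_unique[OF s] by simp
    finally show ?thesis by simp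
  qed
  then show "\<exists>N. \<forall>r\<ge>N. norm (gain l r - 0) < e" by blast
qed

section \<open>Sign pattern of the increments and uniqueness of the maximizer\<close>

definition inv_tail :: "real \<Rightarrow> nat \<Rightarrow> real" where
  "inv_tail l r = (\<Sum>k. poisson_weight l k * (if r < k then 1 / real k else 0))"

lemma summable_inv_tail:
  "l > 0 \<Longrightarrow> summable (\<lambda>k. poisson_weight l k * (if r < k then 1 / real k else 0))"
  by (rule summable_poisson_weight_mult[of _ _ 1]) (auto simp: divide_le_eq)

text \<open>Passing from \<open>r\<close> to \<open>r + 1\<close> drops the summand
  \<open>k = r + 1\<close>, where \<open>cond_gain\<close> is \<open>- 1 / (r + 1)\<close>, and
  lowers the harmonic difference by \<open>1 / (r + 1)\<close> for all larger
  \<open>k\<close>.\<close>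

lemma gain_Suc:
  assumes l: "l > 0"
  shows "gain l (Suc r) - gain l r
       = (poisson_weight l (Suc r) - inv_tail l (Suc r)) / real (Suc r)"
proof -
  let ?n = "Suc r"
  have pw: "cond_gain ?n k - cond_gain r k
      = ((if k = ?n then 1 else 0) - (if ?n < k then 1 / real k else 0)) / real ?n" for k
  proof -
    consider "k < ?n" | "k = ?n" | "k > ?n" by linarith
    then show ?thesis
      by cases (simp_all add: cond_gain_def harm_Suc inverse_eq_divide diff_divide_distrib
          add_divide_distrib del: of_nat_Suc)
  qed
  have f: "(\<lambda>k. poisson_weight l k * (if k = ?n then 1 else 0)) sums poisson_weight l ?n"
    using sums_single[of ?n "poisson_weight l"] by (simp add: if_distrib cong: if_cong)
  have "(\<lambda>k. (poisson_weight l k * (if k = ?n then 1 else 0)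
        - poisson_weight l k * (if ?n < k then 1 / real k else 0)) / real ?n)
      sums ((poisson_weight l ?n - inv_tail l ?n) / real ?n)"
    unfolding inv_tail_def
    by (intro sums_divide sums_diff f summable_sums summable_inv_tail l)
  moreover have "(poisson_weight l k * (if k = ?n then 1 else 0)
        - poisson_weight l k * (if ?n < k then 1 / real k else 0)) / real ?n
      = poisson_weight l k * cond_gain ?n k - poisson_weight l k * cond_gain r k" for k
    using pw[of k] by (metis right_diff_distrib times_divide_eq_right)
  ultimately show ?thesis
    unfolding gain_def suminf_diff[OF summable_cond_gain summable_cond_gain, OF l l]
    by (simp add: sums_iff)
qed

text \<open>Shifting \<open>k\<close> by one gives
  \<open>inv_tail l (r + 1) <= l / (r + 1) * inv_tail l r\<close>, while the weight at
  \<open>r\<close> is multiplied by exactly \<open>l / (r + 1)\<close>.\<close>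

lemma inv_tail_Suc_less:
  assumes l: "l > 0" and less: "inv_tail l r < poisson_weight l r"
  shows "inv_tail l (Suc r) < poisson_weight l (Suc r)"
proof -
  let ?f = "\<lambda>r k. poisson_weight l k * (if r < k then 1 / real k else 0)"
  have "inv_tail l (Suc r) = (\<Sum>k. ?f (Suc r) (Suc k))"
    unfolding inv_tail_def using suminf_split_head[OF summable_inv_tail[OF l, of "Suc r"]] by simp
  also have "\<dots> \<le> (\<Sum>k. l / real (Suc r) * ?f r k)"
  proof (intro suminf_le allI)
    fix k
    show "?f (Suc r) (Suc k) \<le> l / real (Suc r) * ?f r k"
    proof (cases "r < k")
      case True
      have "1 / real (Suc k) * (1 / real (Suc k)) \<le> 1 / real (Suc r) * (1 / real k)"
        using True by (intro mult_mono divide_left_mono) auto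
      then have "(poisson_weight l k * l) * (1 / real (Suc k) * (1 / real (Suc k)))
          \<le> (poisson_weight l k * l) * (1 / real (Suc r) * (1 / real k))"
        using poisson_weight_pos[OF l, of k] l by (intro mult_left_mono) auto
      then show ?thesis using True by (simp add: poisson_weight_Suc mult_ac)
    qed simp
    show "summable (\<lambda>k. ?f (Suc r) (Suc k))"
      using summable_inv_tail[OF l, of "Suc r"] by (subst summable_Suc_iff)
    show "summable (\<lambda>k. l / real (Suc r) * ?f r k)"
      by (intro summable_mult summable_inv_tail l)
  qed
  also have "\<dots> = l / real (Suc r) * inv_tail l r"
    unfolding inv_tail_def by (intro suminf_mult summable_inv_tail l)
  also have "\<dots> < l / real (Suc r) * poisson_weight l r"
    using less l by (intro mult_strict_left_mono) auto
  also have "\<dots> = poisson_weight l (Suc r)"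
    by (simp add: poisson_weight_Suc)
  finally show ?thesis .
qed

lemma gain_increasing_propagates:
  assumes l: "l > 0" and "gain l r < gain l (Suc r)" and "r \<le> s"
  shows "gain l s < gain l (Suc s)"
proof -
  have iff: "gain l r < gain l (Suc r) \<longleftrightarrow> inv_tail l (Suc r) < poisson_weight l (Suc r)" for r
  proof -
    have "gain l r < gain l (Suc r) \<longleftrightarrow>
        0 < (poisson_weight l (Suc r) - inv_tail l (Suc r)) / real (Suc r)"
      unfolding gain_Suc[OF l, symmetric] by simp
    also have "\<dots> \<longleftrightarrow> inv_tail l (Suc r) < poisson_weight l (Suc r)"
      by (simp add: zero_less_divide_iff)
    finally show ?thesis .
  qed
  from \<open>r \<le> s\<close> show ?thesis
  proof (induction s rule: dec_induct)
    case base
    then show ?case by (rule assms(2))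
  next
    case (step s)
    then show ?case using inv_tail_Suc_less[OF l] iff by simp
  qed
qed

text \<open>Once \<open>gain\<close> rises it rises strictly forever; having limit 0, it is then
  negative.\<close>

lemma gain_neg_if_increasing:
  assumes l: "l > 0" and less: "gain l r < gain l (Suc r)" and "r \<le> s"
  shows "gain l s < 0"
proof -
  have inc: "gain l n < gain l (Suc n)" if "s \<le> n" for n
    using gain_increasing_propagates[OF l less] that \<open>r \<le> s\<close> by simp
  have "gain l (Suc s) \<le> gain l n" if "Suc s \<le> n" for n
    using that
  proof (induction n rule: dec_induct)
    case (step n)
    then show ?case using inc[of n] by simp
  qed simp
  then have "gain l (Suc s) \<le> 0"
    by (intro LIMSEQ_le_const[OF gain_tendsto_0[OF l]]) blast
  then show ?thesis using inc[of s] by simp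
qed

text \<open>Downward induction: a rise from \<open>r\<close> to \<open>r + 1\<close> would make
  \<open>gain\<close> negative at \<open>r + 1\<close>, against the induction hypothesis.\<close>

lemma gain_pos_below:
  assumes l: "l > 0" and pos: "gain l s > 0" and "r \<le> s"
  shows "gain l r > 0"
  using \<open>r \<le> s\<close>
proof (induction r rule: inc_induct)
  case base
  show ?case by (rule pos)
next
  case (step r)
  have "\<not> gain l r < gain l (Suc r)"
    using gain_neg_if_increasing[OF l _ le_SucI[OF le_refl], of r] step.IH by force
  then show ?case using step.IH by simp
qed

text \<open>A step without a rise keeps the sign, and a rise forces negativity from there
  on.\<close>

lemma gain_neg_above:
  assumes l: "l > 0" and neg: "gain l s < 0" and "s \<le> r"
  shows "gain l r < 0"
  using \<open>s \<le> r\<close>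
proof (induction r rule: dec_induct)
  case base
  show ?case by (rule neg)
next
  case (step r)
  show ?case
  proof (cases "gain l r < gain l (Suc r)")
    case True
    then show ?thesis by (rule gain_neg_if_increasing[OF l]) simp
  next
    case False
    then show ?thesis using step.IH by simp
  qed
qed

lemma optimal_thresholds_eq_singleton:
  assumes l: "l > 0" and pos: "gain l m > 0" and neg: "gain l (Suc m) < 0"
  shows "optimal_thresholds l = {Suc m}"
proof -
  let ?P = "success_prob l"
  have up: "?P r < ?P (Suc r)" if "r \<le> m" for r
    using success_prob_Suc[OF l, of r] gain_pos_below[OF l pos that] by simp
  have down: "?P (Suc r) < ?P r" if "Suc m \<le> r" for r
    using success_prob_Suc[OF l, of r] gain_neg_above[OF l neg that] by simp
  have "?P r < ?P (Suc m)" if "r < Suc m" for r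
  proof -
    have "Suc r \<le> Suc m" using that by simp
    then have "?P (Suc r) \<le> ?P (Suc m)"
    proof (induction rule: inc_induct)
      case (step n)
      then show ?case using up[of n] by simp
    qed simp
    then show ?thesis using up[of r] that by simp
  qed
  moreover have "?P r < ?P (Suc m)" if "Suc m < r" for r
  proof -
    have "Suc (Suc m) \<le> r" using that by simp
    then show ?thesis
    proof (induction rule: dec_induct)
      case base
      show ?case by (rule down) simp
    next
      case (step n)
      then show ?case using down[of n] by simp
    qed
  qed
  ultimately have "?P r < ?P (Suc m)" if "r \<noteq> Suc m" for r
    using that by (meson linorder_neqE_nat)
  then show ?thesis
    unfolding optimal_thresholds_def
    by (auto simp: not_less[symmetric]) (metis less_irrefl less_asym)+
qed

section \<open>Sharp bounds for the increments\<close>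

text \<open>With \<open>ln (n + 1)\<close>, the choices \<open>n = k - 1\<close> and
  \<open>n = r\<close> produce \<open>ln k\<close> and \<open>ln (r + 1)\<close>; Euler's constant
  cancels in the difference.\<close>

lemma harm_bounds:
  assumes "n \<ge> 1"
  shows "harm n \<le> euler_mascheroni + ln (real n + 1) - 1 / (2 * (real n + 1))"
    and "harm n \<ge> euler_mascheroni + ln (real n + 1) - 1 / (2 * real n)"
proof -
  obtain m where "n = Suc m" using assms by (cases n) auto
  then show "harm n \<le> euler_mascheroni + ln (real n + 1) - 1 / (2 * (real n + 1))"
    "harm n \<ge> euler_mascheroni + ln (real n + 1) - 1 / (2 * real n)"
    using euler_mascheroni_lower[of m] euler_mascheroni_upper[of m]
    by (simp_all add: add_ac distrib_left)
qed

section \<open>Polynomial bounds for the logarithm and reciprocals\<close>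

text \<open>With \<open>y = x - 1\<close>, the expansion of \<open>ln x / x\<close> starts with
  \<open>y - 3/2 * y^2\<close>. Weakening \<open>- 3/2\<close> to \<open>- 1\<close> and adding a
  quartic term absorbs the rest; the gap has its minimum 0 at \<open>x = 1\<close>.\<close>

lemma ln_le_quartic:
  fixes x :: real
  assumes x: "x > 0"
  shows "ln x \<le> x * ((x - 1) - (x - 1)\<^sup>2 + 2 * (x - 1) ^ 4)"
proof -
  define f where "f = (\<lambda>x::real. x * ((x - 1) - (x - 1)\<^sup>2 + 2 * (x - 1) ^ 4) - ln x)"
  \<comment> \<open>The quartic cofactor of \<open>x - 1\<close> is written as a sum of squares, so it is positive.\<close>
  define f' where "f' = (\<lambda>x::real. (x - 1) *
      (10 * ((x - 1)\<^sup>2 + 9/10 * (x - 1) - 1/5)\<^sup>2 + 9/10 * (x - 1 + 1/3)\<^sup>2 + 1/2) / x)"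
  have deriv: "(f has_real_derivative f' z) (at z)" if "z > 0" for z
    unfolding f_def f'_def using that
    by (auto intro!: derivative_eq_intros simp: divide_simps) algebra
  have "f 1 \<le> f x"
  proof (cases "x \<ge> 1")
    case True
    then show ?thesis
    proof (rule DERIV_nonneg_imp_nondecreasing)
      fix z :: real assume "1 \<le> z"
      then have "f' z \<ge> 0"
        by (auto simp: f'_def intro!: divide_nonneg_pos mult_nonneg_nonneg add_nonneg_nonneg)
      then show "\<exists>d. (f has_real_derivative d) (at z) \<and> d \<ge> 0"
        using deriv[of z] \<open>1 \<le> z\<close> by auto
    qed
  next
    case False
    then have "x \<le> 1" by simp
    then show ?thesis
    proof (rule DERIV_nonpos_imp_nonincreasing)
      fix z :: real assume z: "x \<le> z" "z \<le> 1"
      then have "f' z \<le> 0" using x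
        by (auto simp: f'_def intro!: divide_nonpos_pos mult_nonpos_nonneg add_nonneg_nonneg)
      then show "\<exists>d. (f has_real_derivative d) (at z) \<and> d \<le> 0"
        using deriv[of z] z x by auto
    qed
  qed
  then show ?thesis by (simp add: f_def)
qed

lemma recip_le_quadratic:
  fixes x :: real
  assumes "x \<ge> 1 / 3"
  shows "1 / x \<le> 1 - (x - 1) + 3 * (x - 1)\<^sup>2"
proof -
  have "(x - 1)\<^sup>2 * (3 * x - 1) \<ge> 0" using assms by simp
  then show ?thesis using assms
    by (subst pos_divide_le_eq) (auto simp: power2_eq_square algebra_simps)
qed

lemma recip_ge_linear:
  fixes x :: real
  assumes "x > 0"
  shows "1 - (x - 1) \<le> 1 / x"
proof -
  have "(x - 1)\<^sup>2 \<ge> 0" by simp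
  then show ?thesis using assms
    by (simp add: le_divide_eq power2_eq_square algebra_simps)
qed

lemma recip_square_ge_linear:
  fixes x :: real
  assumes "x > 0"
  shows "1 - 2 * (x - 1) \<le> 1 / x\<^sup>2"
proof -
  have "(x - 1)\<^sup>2 * (2 * x + 1) \<ge> 0" using assms by simp
  then show ?thesis using assms
    by (simp add: le_divide_eq power2_eq_square algebra_simps)
qed

text \<open>The constant is 9 + 6, from \<open>1 <= 9 * x^2\<close> and
  \<open>2 * x <= 6 * x^2\<close>. This term carries no factor \<open>l\<close> later, so its size
  costs only \<open>15 / l\<close>.\<close>

lemma recip_square_le_quadratic:
  fixes x :: real
  assumes x: "x \<ge> 1 / 3"
  shows "1 / x\<^sup>2 \<le> 1 - 2 * (x - 1) + 15 * (x - 1)\<^sup>2"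
proof -
  have "1 / 3 * (1 / 3) \<le> x * x" "1 / 3 * x \<le> x * x"
    using x by (intro mult_mono, auto)+
  then have "1 + 2 * x \<le> 15 * (x * x)" by linarith
  then have "(x - 1)\<^sup>2 * (15 * (x * x) - 1 - 2 * x) \<ge> 0" by simp
  then show ?thesis using x
    by (subst pos_divide_le_eq) (auto simp: power2_eq_square algebra_simps)
qed

text \<open>The start is \<open>ln x >= 1 - 1 / x = y / x\<close> with \<open>y = x - 1\<close>. As
  \<open>y / x^2 = y - 2 * y^2 + ...\<close>, the coefficient \<open>- 5/2\<close> leaves slack
  that, with the quartic term, dominates the cubic error down to \<open>x = 1/3\<close>.\<close>

lemma ln_ge_quartic:
  fixes x :: real
  assumes x: "x \<ge> 1 / 3"
  shows "ln x \<ge> x * ((x - 1) - 5 / 2 * (x - 1)\<^sup>2 - 400 * (x - 1) ^ 4)"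
proof -
  define y where "y = x - 1"
  have xp: "x > 0" using x by simp
  have "1 / 3 * (1 / 3) \<le> x * x" using x by (intro mult_mono) auto
  then have "1 / 9 * (1 / 2 + 400 * y\<^sup>2) \<le> (x * x) * (1 / 2 + 400 * y\<^sup>2)"
    by (intro mult_right_mono) auto
  \<comment> \<open>The vertex of this parabola is \<open>- 27 / 836\<close>; the coefficient 400
    makes its discriminant negative.\<close>
  moreover have "0 \<le> 3 * y + 1 / 18 + 400 / 9 * y\<^sup>2 + 2 * y\<^sup>2"
    using zero_le_power2[of "y + 27 / 836"] by (simp add: power2_eq_square algebra_simps)
  ultimately have "0 \<le> y * (3 + 2 * y) + (x * x) * (1 / 2 + 400 * y\<^sup>2)"
    by (simp add: power2_eq_square algebra_simps)
  then have "0 \<le> y\<^sup>2 * (y * (3 + 2 * y) + (x * x) * (1 / 2 + 400 * y\<^sup>2))" by simp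
  also have "\<dots> = y - (x * x) * (y - 5 / 2 * y\<^sup>2 - 400 * y ^ 4)"
    by (simp add: y_def power2_eq_square power4_eq_xxxx field_simps)
  finally have "x * (y - 5 / 2 * y\<^sup>2 - 400 * y ^ 4) \<le> y / x"
    using xp by (simp add: le_divide_eq mult_ac)
  also have "y / x = 1 - 1 / x" using xp by (simp add: y_def field_simps)
  also have "\<dots> \<le> ln x" using ln_le_minus_one[of "1 / x"] xp by (simp add: ln_div)
  finally show ?thesis by (simp add: y_def)
qed

section \<open>Quartic bounds for the summand and their Poisson expectations\<close>

text \<open>\<open>B\<close> collects what does not depend on \<open>k\<close>: for
  \<open>x = k / l\<close> and \<open>k > r\<close>, the harmonic bounds give
  \<open>l * ln x / x + B / x - 1 / (2 * x^2)\<close>, and each piece is estimated around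
  \<open>x = 1\<close>. The constants \<open>1/3\<close> and \<open>2/5\<close> enclose
  \<open>1 / e\<close>.\<close>

lemma cond_gain_le_quartic:
  fixes l :: real and r k :: nat
  defines "B \<equiv> l * (ln (l / (real r + 1)) - 1 + 1 / (2 * real r))" and "y \<equiv> real k / l - 1"
  assumes l: "l \<ge> 5" and r: "r \<ge> 1" "l / 3 \<le> real r + 1" "real r + 1 \<le> 2 / 5 * l" and B: "B \<ge> 0"
  shows "l\<^sup>2 * cond_gain r k \<le> (B - 1 / 2) + (l - B + 1) * y + (3 * B - l) * y\<^sup>2 + 10 * l * y ^ 4"
proof -
  define x where "x = real k / l"
  have yx: "y = x - 1" by (simp add: y_def x_def)
  have rhs: "(B - 1 / 2) + (l - B + 1) * y + (3 * B - l) * y\<^sup>2 + 10 * l * y ^ 4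
      = l * (y - y\<^sup>2 + 2 * y ^ 4) + B * (1 - y + 3 * y\<^sup>2) - 1 / 2 * (1 - 2 * y) + 8 * l * y ^ 4"
    by (simp add: algebra_simps)
  show ?thesis
  proof (cases "r < k")
    case True
    then have k: "real k \<ge> real r + 1" "k \<ge> 2" "k - 1 \<ge> 1" "real (k - 1) = real k - 1"
      using r by auto
    have "1 / 3 * l \<le> real k" using k r by simp
    then have x3: "x \<ge> 1 / 3" using l by (simp add: x_def le_divide_eq)
    have "harm (k - 1) - harm r - 1 \<le> ln (real k) - 1 / (2 * real k)
        - ln (real r + 1) + 1 / (2 * real r) - 1"
      using harm_bounds(1)[OF k(3)] harm_bounds(2)[OF r(1)] unfolding k(4) by simp
    also have "\<dots> = ln x + B / l - 1 / (2 * l * x)"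
      using l k by (simp add: B_def x_def ln_div)
    finally have "l\<^sup>2 * cond_gain r k \<le> l\<^sup>2 * ((ln x + B / l - 1 / (2 * l * x)) / (l * x))"
      using True l k by (intro mult_left_mono) (simp_all add: cond_gain_def x_def divide_right_mono)
    also have "\<dots> = l * (ln x / x) + B * (1 / x) - 1 / 2 * (1 / x\<^sup>2)"
      using l x3 by (simp add: field_simps power2_eq_square)
    also have "\<dots> \<le> l * (y - y\<^sup>2 + 2 * y ^ 4) + B * (1 - y + 3 * y\<^sup>2) - 1 / 2 * (1 - 2 * y)"
    proof -
      have "ln x / x \<le> y - y\<^sup>2 + 2 * y ^ 4"
        using ln_le_quartic[of x] x3 by (simp add: yx divide_le_eq mult_ac)
      then show ?thesis unfolding yx
        using recip_le_quadratic[OF x3] recip_square_ge_linear[of x] x3 l B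
        by (intro diff_mono add_mono mult_left_mono) auto
    qed
    \<comment> \<open>This surplus is what lets the same polynomial also cover
      \<open>k <= r\<close>.\<close>
    also have "\<dots> \<le> \<dots> + 8 * l * y ^ 4" using l by simp
    finally show ?thesis unfolding rhs .
  next
    case False
    \<comment> \<open>Here \<open>y\<close> stays away from 0, so the terms with factor \<open>l\<close> dominate.\<close>
    then have "real k \<le> 2 / 5 * l" using r by linarith
    then have y: "y \<le> - 3 / 5" using l by (simp add: y_def field_simps)
    have y1: "y \<ge> -1" using l by (simp add: y_def)
    have y2: "9 / 25 \<le> y\<^sup>2" using power_mono[of "3/5" "- y" 2] y by (simp add: power2_eq_square)
    have "9 / 25 * (10 * y\<^sup>2 - 1) \<le> y\<^sup>2 * (10 * y\<^sup>2 - 1)"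
      using y2 by (intro mult_right_mono) auto
    then have "y - y\<^sup>2 + 10 * y ^ 4 \<ge> y + 18 / 5 * y\<^sup>2 - 9 / 25"
      by (simp add: power2_eq_square power4_eq_xxxx field_simps)
    moreover have "y + 18 / 5 * y\<^sup>2 - 9 / 25 \<ge> 3 / 10"
    proof -
      have "(- y - 3 / 5) * (- y) \<ge> 0" using y by (intro mult_nonneg_nonneg) auto
      then have "y\<^sup>2 \<ge> - 3 / 5 * y" by (simp add: power2_eq_square algebra_simps)
      then show ?thesis using y by linarith
    qed
    \<comment> \<open>For \<open>l >= 5\<close> the lower bound is at least \<open>3/2\<close>,
      which covers \<open>1/2 * (1 - 2 * y)\<close> since \<open>y >= - 1\<close>.\<close>
    ultimately have "l * (y - y\<^sup>2 + 10 * y ^ 4) \<ge> l * (3 / 10)"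
      using l by (intro mult_left_mono) auto
    moreover have "B * (1 - y + 3 * y\<^sup>2) \<ge> 0" using B y by (intro mult_nonneg_nonneg) auto
    ultimately have "0 \<le> l * (y - y\<^sup>2 + 10 * y ^ 4) + B * (1 - y + 3 * y\<^sup>2) - 1 / 2 * (1 - 2 * y)"
      using add_mono[of "l * (3 / 10)" "l * (y - y\<^sup>2 + 10 * y ^ 4)" 0 "B * (1 - y + 3 * y\<^sup>2)"] l y1
      by argo
    then show ?thesis unfolding rhs using False by (simp add: cond_gain_def algebra_simps)
  qed
qed

lemma cond_gain_ge_quartic:
  fixes l :: real and r k :: nat
  defines "B \<equiv> l * (ln (l / (real r + 1)) - 1 + 1 / (2 * (real r + 1)))" and "y \<equiv> real k / l - 1"
  assumes l: "l \<ge> 20" and r: "r \<ge> 1" "l / 3 \<le> real r + 1" "real r + 1 \<le> 2 / 5 * l"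
    and B: "B \<ge> 0" "B \<le> 6"
  shows "l\<^sup>2 * cond_gain r k
      \<ge> (B - 1) + (l - B + 2) * y + (- 5 / 2 * l - 15) * y\<^sup>2 + (- 400 * l) * y ^ 4"
proof -
  define x where "x = real k / l"
  have yx: "y = x - 1" by (simp add: y_def x_def)
  have rhs: "(B - 1) + (l - B + 2) * y + (- 5 / 2 * l - 15) * y\<^sup>2 + (- 400 * l) * y ^ 4
      = l * (y - 5 / 2 * y\<^sup>2 - 400 * y ^ 4) + B * (1 - y) - (1 - 2 * y + 15 * y\<^sup>2)"
    by (simp add: algebra_simps)
  show ?thesis
  proof (cases "r < k")
    case True
    then have k: "real k \<ge> real r + 1" "k \<ge> 2" "k - 1 \<ge> 1" "real (k - 1) = real k - 1"
      using r by auto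
    have "1 / 3 * l \<le> real k" using k r by simp
    then have x3: "x \<ge> 1 / 3" using l by (simp add: x_def le_divide_eq)
    \<comment> \<open>Needs \<open>k >= 2\<close>. The harmonic error is relaxed to
      \<open>1 / k\<close>, twice its leading order, to stay a function of
      \<open>k / l\<close>.\<close>
    have "1 / (2 * (real k - 1)) \<le> 1 / real k" using k by (intro divide_left_mono) auto
    then have "harm (k - 1) - harm r - 1 \<ge> ln (real k) - 1 / real k
        - ln (real r + 1) + 1 / (2 * (real r + 1)) - 1"
      using harm_bounds(2)[OF k(3)] harm_bounds(1)[OF r(1)] unfolding k(4) by simp
    moreover have "ln (real k) - 1 / real k - ln (real r + 1) + 1 / (2 * (real r + 1)) - 1
        = ln x + B / l - 1 / (l * x)"
      using l k by (simp add: B_def x_def ln_div)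
    ultimately have "l\<^sup>2 * cond_gain r k \<ge> l\<^sup>2 * ((ln x + B / l - 1 / (l * x)) / (l * x))"
      using True l k by (intro mult_left_mono) (simp_all add: cond_gain_def x_def divide_right_mono)
    moreover have "l\<^sup>2 * ((ln x + B / l - 1 / (l * x)) / (l * x))
        = l * (ln x / x) + B * (1 / x) - 1 / x\<^sup>2"
      using l x3 by (simp add: field_simps power2_eq_square)
    moreover have "\<dots> \<ge> l * (y - 5 / 2 * y\<^sup>2 - 400 * y ^ 4) + B * (1 - y) - (1 - 2 * y + 15 * y\<^sup>2)"
    proof -
      have "ln x / x \<ge> y - 5 / 2 * y\<^sup>2 - 400 * y ^ 4"
        using ln_ge_quartic[OF x3] x3 by (simp add: yx le_divide_eq mult_ac)
      then show ?thesis unfolding yx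
        using recip_ge_linear[of x] recip_square_le_quadratic[OF x3] x3 l B
        by (intro diff_mono add_mono mult_left_mono) auto
    qed
    ultimately show ?thesis unfolding rhs by simp
  next
    case False
    \<comment> \<open>Here \<open>y\<close> stays away from 0, so the terms with factor \<open>l\<close> dominate.\<close>
    then have "real k \<le> 2 / 5 * l" using r by linarith
    then have y: "y \<le> - 3 / 5" using l by (simp add: y_def field_simps)
    have y1: "y \<ge> -1" using l by (simp add: y_def)
    have "y\<^sup>2 \<ge> 0" "y ^ 4 \<ge> 0" by auto
    then have "y - 5 / 2 * y\<^sup>2 - 400 * y ^ 4 \<le> - 3 / 5" using y by linarith
    then have "l * (y - 5 / 2 * y\<^sup>2 - 400 * y ^ 4) \<le> l * (- 3 / 5)"
      using l by (intro mult_left_mono) auto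
    \<comment> \<open>The hypotheses \<open>l >= 20\<close> and \<open>B <= 6\<close> are matched
      here: \<open>3/5 * l >= 12 = 6 * 2\<close>.\<close>
    moreover have "B * (1 - y) \<le> 6 * 2" using B y y1 by (intro mult_mono) auto
    moreover have "1 - 2 * y + 15 * y\<^sup>2 \<ge> 0" using y by (intro add_nonneg_nonneg) auto
    ultimately have "l * (y - 5 / 2 * y\<^sup>2 - 400 * y ^ 4) + B * (1 - y) - (1 - 2 * y + 15 * y\<^sup>2) \<le> 0"
      using l by linarith
    then show ?thesis unfolding rhs using False by (simp add: cond_gain_def)
  qed
qed

text \<open>For bounded \<open>B\<close> the bound tends to \<open>B - 3/2\<close> up to
  \<open>o(1)\<close>, where the sharp value is \<open>B - 2\<close>.\<close>

lemma gain_le: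
  fixes l :: real and r :: nat
  defines "B \<equiv> l * (ln (l / (real r + 1)) - 1 + 1 / (2 * real r))"
  assumes l: "l \<ge> 5" and r: "r \<ge> 1" "l / 3 \<le> real r + 1" "real r + 1 \<le> 2 / 5 * l" and B: "B \<ge> 0"
  shows "l\<^sup>2 * gain l r \<le> B - 3 / 2 + 3 * B / l + 10 * (3 / l + 1 / l\<^sup>2)"
proof -
  have lp: "l > 0" using l by simp
  have 1: "(\<lambda>k. poisson_weight l k * (l\<^sup>2 * cond_gain r k)) sums (l\<^sup>2 * gain l r)"
    using sums_mult[OF summable_sums[OF summable_cond_gain[OF lp, of r]], of "l\<^sup>2"]
    by (simp add: gain_def mult_ac)
  have "l\<^sup>2 * gain l r \<le> (B - 1 / 2) + (3 * B - l) / l + 10 * l * (3 / l\<^sup>2 + 1 / l ^ 3)"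
    \<comment> \<open>The linear coefficient is supplied by hand, since it does not occur in the
      value of the sum.\<close>
    by (rule sums_le[OF _ 1 poisson_scaled_quartic_sums[OF lp, of _ "l - B + 1"]])
       (intro mult_left_mono less_imp_le[OF poisson_weight_pos] lp
         cond_gain_le_quartic[OF l r B[unfolded B_def], folded B_def])
  also have "\<dots> = B - 3 / 2 + 3 * B / l + 10 * (3 / l + 1 / l\<^sup>2)"
    using lp by (simp add: field_simps power2_eq_square power3_eq_cube)
  finally show ?thesis .
qed

text \<open>The loss against \<open>B - 2\<close> is \<open>1/2\<close> from the harmonic error and
  1 from the logarithm; the constants 15 and 400 enter only in vanishing terms.\<close>

lemma gain_ge:
  fixes l :: real and r :: nat
  defines "B \<equiv> l * (ln (l / (real r + 1)) - 1 + 1 / (2 * (real r + 1)))"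
  assumes l: "l \<ge> 20" and r: "r \<ge> 1" "l / 3 \<le> real r + 1" "real r + 1 \<le> 2 / 5 * l"
    and B: "B \<ge> 0" "B \<le> 6"
  shows "l\<^sup>2 * gain l r \<ge> B - 7 / 2 - 15 / l - 400 * (3 / l + 1 / l\<^sup>2)"
proof -
  have lp: "l > 0" using l by simp
  have 1: "(\<lambda>k. poisson_weight l k * (l\<^sup>2 * cond_gain r k)) sums (l\<^sup>2 * gain l r)"
    using sums_mult[OF summable_sums[OF summable_cond_gain[OF lp, of r]], of "l\<^sup>2"]
    by (simp add: gain_def mult_ac)
  have "B - 7 / 2 - 15 / l - 400 * (3 / l + 1 / l\<^sup>2)
      = (B - 1) + (- 5 / 2 * l - 15) / l + (- 400 * l) * (3 / l\<^sup>2 + 1 / l ^ 3)"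
    using lp by (simp add: field_simps power2_eq_square power3_eq_cube)
  also have "\<dots> \<le> l\<^sup>2 * gain l r"
    by (rule sums_le[OF _ poisson_scaled_quartic_sums[OF lp, of _ "l - B + 2"] 1])
       (intro mult_left_mono less_imp_le[OF poisson_weight_pos] lp
         cond_gain_ge_quartic[OF l r B[unfolded B_def], folded B_def])
  finally show ?thesis .
qed

section \<open>Asymptotics\<close>

text \<open>The hypotheses force \<open>u\<close> to 0; then
  \<open>u / (1 + u) <= ln (1 + u) <= u\<close> squeezes the limit.\<close>

lemma tendsto_mult_ln_one_plus:
  fixes l u :: "'a \<Rightarrow> real"
  assumes l: "filterlim l at_top F" and lu: "((\<lambda>j. l j * u j) \<longlongrightarrow> c) F"
  shows "((\<lambda>j. l j * ln (1 + u j)) \<longlongrightarrow> c) F"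
proof -
  have pos: "\<forall>\<^sub>F j in F. l j > 0"
    using l by (simp add: filterlim_at_top_dense)
  have "((\<lambda>j. (l j * u j) * inverse (l j)) \<longlongrightarrow> c * 0) F"
    by (intro tendsto_mult lu tendsto_inverse_0_at_top l)
  moreover have "\<forall>\<^sub>F j in F. (l j * u j) * inverse (l j) = u j"
    using pos by eventually_elim simp
  ultimately have u: "(u \<longlongrightarrow> 0) F" by (simp add: tendsto_cong)
  have u1: "\<forall>\<^sub>F j in F. u j > -1"
    using order_tendstoD(1)[OF u, of "-1"] by simp
  show ?thesis
  proof (rule tendsto_sandwich)
    have "((\<lambda>j. l j * u j / (1 + u j)) \<longlongrightarrow> c / (1 + 0)) F"
      by (intro tendsto_intros lu u) simp
    then show "((\<lambda>j. l j * u j / (1 + u j)) \<longlongrightarrow> c) F" by simp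
    show "((\<lambda>j. l j * u j) \<longlongrightarrow> c) F" by (rule lu)
    show "\<forall>\<^sub>F j in F. l j * u j / (1 + u j) \<le> l j * ln (1 + u j)"
      using pos u1
    proof eventually_elim
      case (elim j)
      have "u j / (1 + u j) = 1 - 1 / (1 + u j)" using elim by (simp add: field_simps)
      also have "\<dots> \<le> ln (1 + u j)"
        using ln_le_minus_one[of "1 / (1 + u j)"] elim by (simp add: ln_div)
      finally show ?case using elim by (simp flip: times_divide_eq_right)
    qed
    show "\<forall>\<^sub>F j in F. l j * ln (1 + u j) \<le> l j * u j"
      using pos u1
    proof eventually_elim
      case (elim j)
      then show ?case using ln_le_minus_one[of "1 + u j"] by simp
    qed
  qed
qed

text \<open>This resolves single steps of the threshold: moving \<open>s\<close> by 1 moves the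
  second limit by \<open>- e\<close>.\<close>

lemma scaled_ln_tendsto:
  fixes l s :: "nat \<Rightarrow> real"
  assumes l: "filterlim l at_top sequentially"
    and s: "(\<lambda>j. s j - 1 / exp 1 * l j) \<longlonglongrightarrow> d"
  shows "(\<lambda>j. s j / l j) \<longlonglongrightarrow> 1 / exp 1"
    and "(\<lambda>j. l j * (ln (l j / s j) - 1)) \<longlonglongrightarrow> - (exp 1 * d)"
proof -
  have pos: "\<forall>\<^sub>F j in sequentially. l j > 0"
    using l by (simp add: filterlim_at_top_dense)
  have "(\<lambda>j. (s j - 1 / exp 1 * l j) * inverse (l j) + 1 / exp 1) \<longlonglongrightarrow> d * 0 + 1 / exp 1"
    by (intro tendsto_intros s tendsto_inverse_0_at_top l)
  moreover have "\<forall>\<^sub>F j in sequentially.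
      (s j - 1 / exp 1 * l j) * inverse (l j) + 1 / exp 1 = s j / l j"
    using pos by eventually_elim (simp add: field_simps)
  ultimately show lim: "(\<lambda>j. s j / l j) \<longlonglongrightarrow> 1 / exp 1"
    by (simp add: tendsto_cong)
  \<comment> \<open>Chosen so that \<open>e * s / l = 1 + u\<close>, hence
    \<open>ln (l / s) - 1 = - ln (1 + u)\<close>.\<close>
  define u where "u j = exp 1 * (s j / l j) - 1" for j
  have "(\<lambda>j. exp 1 * (s j - 1 / exp 1 * l j)) \<longlonglongrightarrow> exp 1 * d"
    by (intro tendsto_intros s)
  moreover have "\<forall>\<^sub>F j in sequentially. exp 1 * (s j - 1 / exp 1 * l j) = l j * u j"
    using pos by eventually_elim (simp add: u_def field_simps)
  ultimately have "(\<lambda>j. l j * u j) \<longlonglongrightarrow> exp 1 * d" by (rule Lim_transform_eventually)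
  from tendsto_minus[OF tendsto_mult_ln_one_plus[OF l this]]
  have "(\<lambda>j. - (l j * ln (1 + u j))) \<longlonglongrightarrow> - (exp 1 * d)" .
  moreover have "\<forall>\<^sub>F j in sequentially. s j / l j > 0"
    using order_tendstoD(1)[OF lim, of 0] by simp
  with pos have "\<forall>\<^sub>F j in sequentially. - (l j * ln (1 + u j)) = l j * (ln (l j / s j) - 1)"
  proof eventually_elim
    case (elim j)
    then have "s j > 0" by (simp add: zero_less_divide_iff)
    then show ?case using elim by (simp add: u_def ln_mult ln_div algebra_simps)
  qed
  ultimately show "(\<lambda>j. l j * (ln (l j / s j) - 1)) \<longlonglongrightarrow> - (exp 1 * d)"
    by (rule Lim_transform_eventually)
qed

lemma exp_1_bounds: "5 / 2 < exp (1::real)" "exp (1::real) < 3"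
proof -
  have "13 / 8 \<le> exp (1 / 2 :: real)"
    using exp_lower_Taylor_quadratic[of "1 / 2 :: real"] by (simp add: power2_eq_square)
  then have "(13 / 8) ^ 2 \<le> exp (1 / 2 :: real) ^ 2" by (intro power_mono) auto
  also have "\<dots> = exp 1" by (simp flip: exp_of_nat_mult)
  finally show "5 / 2 < exp (1::real)" by (simp add: power2_eq_square)
  \<comment> \<open>At \<open>1/2\<close> the bound \<open>1 + x + x^2\<close> would only give
    \<open>(7/4)^2 > 3\<close>.\<close>
  have "exp (1 / 4 :: real) \<le> 21 / 16"
    using exp_bound[of "1 / 4 :: real"] by (simp add: power2_eq_square)
  then have "exp (1 / 4 :: real) ^ 4 \<le> (21 / 16) ^ 4" by (intro power_mono) auto
  also have "exp (1 / 4 :: real) ^ 4 = exp 1" by (simp flip: exp_of_nat_mult)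
  finally show "exp (1::real) < 3" by (simp add: power4_eq_xxxx)
qed

theorem mainTheorem10:
  fixes p q :: "nat \<Rightarrow> int"
  assumes "filterlim q at_top sequentially"
    and "(\<lambda>j. real_of_int (p j) - 1 / exp 1 * real_of_int (q j)) \<longlonglongrightarrow> 0"
  shows "\<forall>\<^sub>F j in sequentially.
           \<exists>t::nat. int t = p j - 1 \<and> optimal_thresholds (real_of_int (q j)) = {t}"
proof -
  let ?e = "exp (1::real)"
  define l where "l j = real_of_int (q j)" for j
  define P where "P j = real_of_int (p j)" for j
  \<comment> \<open>Common form of the \<open>B\<close> in \<open>gain_le\<close> at
    \<open>r = p - 1\<close> (\<open>s = P\<close>) and in \<open>gain_ge\<close> at
    \<open>r = p - 2\<close> (\<open>s = P - 1\<close>); the last term has denominator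
    \<open>2 * (P - 1)\<close> in both.\<close>
  define B where "B s j = l j * (ln (l j / s j) - 1) + 1 / 2 * inverse ((P j - 1) / l j)"
    for s :: "nat \<Rightarrow> real" and j
  have l: "filterlim l at_top sequentially"
    unfolding l_def by (rule filterlim_compose[OF filterlim_real_of_int_at_top assms(1)])
  have p0: "(\<lambda>j. P j - 1 / ?e * l j) \<longlonglongrightarrow> 0"
    using assms(2) unfolding l_def P_def .
  have p1: "(\<lambda>j. (P j - 1) - 1 / ?e * l j) \<longlonglongrightarrow> - 1"
    using tendsto_diff[OF p0 tendsto_const[of 1]] by (simp add: algebra_simps)
  note ratio0 = scaled_ln_tendsto(1)[OF l p0]
  note ratio1 = scaled_ln_tendsto(1)[OF l p1]
  have e: "1 / 3 < 1 / ?e" "1 / ?e < 2 / 5" using exp_1_bounds by (simp_all add: field_simps)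
  have l2: "filterlim (\<lambda>j. (l j)\<^sup>2) at_top sequentially"
    by (rule filterlim_pow_at_top[OF _ l]) simp
  have "B P \<longlonglongrightarrow> - (?e * 0) + 1 / 2 * inverse (1 / ?e)"
    unfolding B_def by (intro tendsto_intros scaled_ln_tendsto(2)[OF l p0] ratio1) simp
  then have B0: "B P \<longlonglongrightarrow> ?e / 2" by simp
  have "B (\<lambda>j. P j - 1) \<longlonglongrightarrow> - (?e * - 1) + 1 / 2 * inverse (1 / ?e)"
    unfolding B_def by (intro tendsto_intros scaled_ln_tendsto(2)[OF l p1] ratio1) simp
  then have B1: "B (\<lambda>j. P j - 1) \<longlonglongrightarrow> 3 / 2 * ?e" by simp
  note inv = real_tendsto_divide_at_top[OF tendsto_const l]
    real_tendsto_divide_at_top[OF tendsto_mult[OF tendsto_const B0] l]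
    real_tendsto_divide_at_top[OF tendsto_const l2]
  \<comment> \<open>The limit is negative because \<open>e < 3\<close>.\<close>
  have "(\<lambda>j. B P j - 3 / 2 + 3 * B P j / l j + 10 * (3 / l j + 1 / (l j)\<^sup>2))
      \<longlonglongrightarrow> ?e / 2 - 3 / 2 + 0 + 10 * (0 + 0)"
    by (intro tendsto_add tendsto_diff tendsto_mult B0 inv tendsto_const)
  from order_tendstoD(2)[OF this, of 0] have upper: "\<forall>\<^sub>F j in sequentially.
      B P j - 3 / 2 + 3 * B P j / l j + 10 * (3 / l j + 1 / (l j)\<^sup>2) < 0"
    using exp_1_bounds by simp
  \<comment> \<open>The limit is positive because \<open>e > 5/2 > 7/3\<close>.\<close>
  have "(\<lambda>j. B (\<lambda>j. P j - 1) j - 7 / 2 - 15 / l j - 400 * (3 / l j + 1 / (l j)\<^sup>2))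
      \<longlonglongrightarrow> 3 / 2 * ?e - 7 / 2 - 0 - 400 * (0 + 0)"
    by (intro tendsto_add tendsto_diff tendsto_mult B1 inv tendsto_const)
  from order_tendstoD(1)[OF this, of 0] have lower: "\<forall>\<^sub>F j in sequentially.
      0 < B (\<lambda>j. P j - 1) j - 7 / 2 - 15 / l j - 400 * (3 / l j + 1 / (l j)\<^sup>2)"
    using exp_1_bounds by simp
  have B_bounds: "\<forall>\<^sub>F j in sequentially. B P j > 0"
    "\<forall>\<^sub>F j in sequentially. B (\<lambda>j. P j - 1) j > 0"
    "\<forall>\<^sub>F j in sequentially. B (\<lambda>j. P j - 1) j < 6"
    using order_tendstoD(1)[OF B0, of 0] order_tendstoD[OF B1, of 0] order_tendstoD[OF B1, of 6]
      exp_1_bounds by auto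
  have "\<forall>\<^sub>F j in sequentially. l j \<ge> 20"
    using l by (simp add: filterlim_at_top)
  with upper lower B_bounds order_tendstoD(1)[OF ratio1 e(1)] order_tendstoD(2)[OF ratio0 e(2)]
  show ?thesis
  proof eventually_elim
    case (elim j)
    have lj: "l j \<ge> 5" "l j \<ge> 20" "l j > 0" using elim by auto
    have P: "l j / 3 \<le> P j - 1" "P j \<le> 2 / 5 * l j" using elim lj by (simp_all add: field_simps)
    then have "P j > 6" using lj by simp
    then have "p j \<ge> 3" by (simp add: P_def)
    \<comment> \<open>Thus \<open>Suc m\<close> is the claimed optimum \<open>p - 1\<close>, and the
      signs of \<open>gain\<close> at \<open>m\<close> and \<open>Suc m\<close> decide.\<close>
    define m where "m = nat (p j - 2)"
    have m: "real m + 1 = P j - 1" "real (Suc m) = P j - 1" "int (Suc m) = p j - 1" "m \<ge> 1"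
      using \<open>p j \<ge> 3\<close> by (auto simp: m_def P_def)
    have "l j * (ln (l j / (real (Suc m) + 1)) - 1 + 1 / (2 * real (Suc m))) = B P j"
      using \<open>P j > 6\<close> unfolding m(2) B_def by (simp add: distrib_left)
    then have "(l j)\<^sup>2 * gain (l j) (Suc m) < 0"
      using gain_le[of "l j" "Suc m"] lj P elim m(2) by simp
    then have neg: "gain (l j) (Suc m) < 0"
      using lj by (simp add: mult_less_0_iff)
    have "l j * (ln (l j / (real m + 1)) - 1 + 1 / (2 * (real m + 1))) = B (\<lambda>j. P j - 1) j"
      using \<open>P j > 6\<close> unfolding m(1) B_def by (simp add: distrib_left)
    then have "(l j)\<^sup>2 * gain (l j) m > 0"
      using gain_ge[of "l j" m] lj P elim m(1,4) by simp
    then have "gain (l j) m > 0"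
      using lj by (simp add: zero_less_mult_iff)
    then have "optimal_thresholds (l j) = {Suc m}"
      by (rule optimal_thresholds_eq_singleton[OF lj(3) _ neg])
    then show ?case using m(3) unfolding l_def by blast
  qed
qed

end
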